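(* Two Hilbert algebras have isomorphic adjoint semilattices if and only if their filter lattices are isomorphic.
   Context: A Hilbert algebra $(A,\to,1)$ is a poset with greatest element $1$ and a binary operation $\to$ such that $x \to y = 1$ iff $x \le y$; $x \le y \to x$; and $x \to (y \to z) \le (x \to y) \to (x \to z)$. A closure endomorphism of $A$ is a map $\phi\colon A\to A$ that is an endomorphism ($\phi(x\to y)=\phi x\to\phi y$) and a closure operator (isotone, $x\le\phi x$, $\phi\phi x=\phi x$). The set $CE$ of all closure endomorphisms of $A$, ordered pointwise, is a bounded distributive lattice in which join is composition. For $p\in A$, the map $\alpha_p\colon x\mapsto p\to x$ is a closure endomorphism (called principal). A closure endomorphism is finitely generated if it is a composition of a finite number of principal closure endomorphisms (the empty composition being the identity map). The set $CE^f$ of finitely generated closure endomorphisms of $A$ is closed under composition; this join semilattice is called the adjoint semilattice of $A$. A filter of $A$ is a subset $J\ni 1$ such that $y\in J$ whenever $x, x\to y\in J$. The filter lattice of $A$ is the lattice of all filters of $A$ ordered by inclusion. *)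

theory Defs
  imports "HOL.Hull"
begin

locale hilbert_algebra =
  fixes le :: "'a \<Rightarrow> 'a \<Rightarrow> bool"
    and imp :: "'a \<Rightarrow> 'a \<Rightarrow> 'a"
    and one :: 'a
  assumes le_refl: "le x x"
    and le_trans: "le x y \<Longrightarrow> le y z \<Longrightarrow> le x z"
    and le_antisym: "le x y \<Longrightarrow> le y x \<Longrightarrow> x = y"
    and le_one: "le x one"
    and imp_eq_one_iff: "imp x y = one \<longleftrightarrow> le x y"
    and le_imp: "le x (imp y x)"
    and imp_distrib: "le (imp x (imp y z)) (imp (imp x y) (imp x z))"

definition closure_endomorphism ::
    "('a \<Rightarrow> 'a \<Rightarrow> bool) \<Rightarrow> ('a \<Rightarrow> 'a \<Rightarrow> 'a) \<Rightarrow> ('a \<Rightarrow> 'a) \<Rightarrow> bool" where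
  "closure_endomorphism le imp \<phi> \<longleftrightarrow>
     (\<forall>x y. \<phi> (imp x y) = imp (\<phi> x) (\<phi> y)) \<and>
     monotone le le \<phi> \<and> (\<forall>x. le x (\<phi> x)) \<and> (\<forall>x. \<phi> (\<phi> x) = \<phi> x)"

definition principal_map :: "('a \<Rightarrow> 'a \<Rightarrow> 'a) \<Rightarrow> 'a \<Rightarrow> 'a \<Rightarrow> 'a" where
  "principal_map imp p = (\<lambda>x. imp p x)"

definition fg_closure_endomorphisms ::
    "('a \<Rightarrow> 'a \<Rightarrow> bool) \<Rightarrow> ('a \<Rightarrow> 'a \<Rightarrow> 'a) \<Rightarrow> ('a \<Rightarrow> 'a) set" where
  "fg_closure_endomorphisms le imp =
     {\<phi>. closure_endomorphism le imp \<phi> \<and>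
          (\<exists>ps. \<phi> = foldr (\<circ>) (map (principal_map imp) ps) id)}"

definition hilbert_filter :: "('a \<Rightarrow> 'a \<Rightarrow> 'a) \<Rightarrow> 'a \<Rightarrow> 'a set \<Rightarrow> bool" where
  "hilbert_filter imp one J \<longleftrightarrow> one \<in> J \<and> (\<forall>x y. x \<in> J \<longrightarrow> imp x y \<in> J \<longrightarrow> y \<in> J)"

text \<open>Composition is the pointwise-order join of closure endomorphisms
  (\<open>closure_endomorphism_comp_lub\<close> below).  Under inclusion, the meet of two filters is their intersection; their join is the
  least filter containing both (\<open>filter_meet\<close> and \<open>filter_join_lub\<close> below).\<close>

definition filter_join :: "('a \<Rightarrow> 'a \<Rightarrow> 'a) \<Rightarrow> 'a \<Rightarrow> 'a set \<Rightarrow> 'a set \<Rightarrow> 'a set" where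
  "filter_join imp one F G = (hilbert_filter imp one) hull (F \<union> G)"

definition isomorphic_semilattices ::
    "'a set \<Rightarrow> ('a \<Rightarrow> 'a \<Rightarrow> 'a) \<Rightarrow> 'b set \<Rightarrow> ('b \<Rightarrow> 'b \<Rightarrow> 'b) \<Rightarrow> bool" where
  "isomorphic_semilattices S join T join' \<longleftrightarrow>
     (\<exists>f. bij_betw f S T \<and> (\<forall>x\<in>S. \<forall>y\<in>S. f (join x y) = join' (f x) (f y)))"

definition isomorphic_lattices ::
    "'a set \<Rightarrow> ('a \<Rightarrow> 'a \<Rightarrow> 'a) \<Rightarrow> ('a \<Rightarrow> 'a \<Rightarrow> 'a) \<Rightarrow>
     'b set \<Rightarrow> ('b \<Rightarrow> 'b \<Rightarrow> 'b) \<Rightarrow> ('b \<Rightarrow> 'b \<Rightarrow> 'b) \<Rightarrow> bool" where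
  "isomorphic_lattices S meet join T meet' join' \<longleftrightarrow>
     (\<exists>f. bij_betw f S T \<and>
          (\<forall>x\<in>S. \<forall>y\<in>S. f (meet x y) = meet' (f x) (f y) \<and> f (join x y) = join' (f x) (f y)))"

lemma filter_meet:
  assumes "hilbert_filter imp one F" "hilbert_filter imp one G"
  shows "hilbert_filter imp one (F \<inter> G)"
  using assms unfolding hilbert_filter_def by blast

lemma filter_join_lub:
  shows "hilbert_filter imp one (filter_join imp one F G)"
    and "hilbert_filter imp one H \<Longrightarrow> filter_join imp one F G \<subseteq> H \<longleftrightarrow> F \<subseteq> H \<and> G \<subseteq> H"
proof -
  show "hilbert_filter imp one (filter_join imp one F G)"
    unfolding filter_join_def by (rule hull_in) (unfold hilbert_filter_def, blast)
  show "filter_join imp one F G \<subseteq> H \<longleftrightarrow> F \<subseteq> H \<and> G \<subseteq> H" if "hilbert_filter imp one H"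
    using that
    unfolding filter_join_def by (simp add: subset_hull)
qed

context hilbert_algebra
begin

lemma one_imp: "imp one x = x"
proof (rule le_antisym)
  have one: "y = one" if "le one y" for y using that le_one le_antisym by blast
  have "le (imp (imp one x) (imp one x))
      (imp (imp (imp one x) one) (imp (imp one x) x))" by (rule imp_distrib)
  moreover have "imp (imp one x) (imp one x) = one" "imp (imp one x) one = one"
    by (simp_all add: imp_eq_one_iff le_refl le_one)
  ultimately show "le (imp one x) x" by (metis one imp_eq_one_iff)
qed (rule le_imp)

lemma imp_mono: assumes "le x y" shows "le (imp p x) (imp p y)"
proof -
  have "imp x y = one" "imp p one = one" using assms by (simp_all add: imp_eq_one_iff le_one)
  then have "imp p (imp x y) = one" by simp
  then have "le one (imp (imp p x) (imp p y))" using imp_distrib[of p x y] by simp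
  then have "imp (imp p x) (imp p y) = one" using le_one le_antisym by blast
  then show ?thesis by (simp add: imp_eq_one_iff)
qed

lemma imp_antimono: assumes "le x y" shows "le (imp y z) (imp x z)"
proof -
  have "le (imp y z) (imp (imp x y) (imp x z))"
    by (rule le_trans[OF le_imp imp_distrib])
  moreover have "imp x y = one" using assms imp_eq_one_iff by simp
  ultimately show ?thesis by (simp add: one_imp)
qed

lemma imp_exchange: "imp p (imp q x) = imp q (imp p x)"
proof -
  have "le (imp p (imp q x)) (imp q (imp p x))" for p q x
    by (rule le_trans[OF imp_distrib imp_antimono[OF le_imp]])
  then show ?thesis by (intro le_antisym)
qed

lemma imp_imp: "imp p (imp x y) = imp (imp p x) (imp p y)"
proof (rule le_antisym[OF imp_distrib])
  have "le (imp (imp p x) (imp p y)) (imp x (imp p y))"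
    by (rule imp_antimono[OF le_imp])
  then show "le (imp (imp p x) (imp p y)) (imp p (imp x y))"
    by (simp add: imp_exchange)
qed

lemma imp_idem: "imp p (imp p x) = imp p x"
proof -
  have "imp p p = one" by (simp add: imp_eq_one_iff le_refl)
  then show ?thesis using imp_imp[of p p x] one_imp by metis
qed

lemma closure_endomorphism_principal: "closure_endomorphism le imp (principal_map imp p)"
  by (simp add: closure_endomorphism_def principal_map_def monotone_def
      imp_imp[symmetric] imp_mono le_imp imp_idem)

lemma closure_endomorphism_composition:
  "closure_endomorphism le imp (foldr (\<circ>) (map (principal_map imp) ps) id)"
proof (induction ps)
  case Nil
  then show ?case by (simp add: closure_endomorphism_def monotone_def le_refl)
next
  case (Cons p ps)
  define g where "g = foldr (\<circ>) (map (principal_map imp) ps) id"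
  have eq: "foldr (\<circ>) (map (principal_map imp) (p # ps)) id = (\<lambda>x. imp p (g x))"
    by (auto simp: g_def principal_map_def)
  have comm: "g (imp p x) = imp p (g x)" for x
    unfolding g_def by (induction ps) (simp_all add: principal_map_def imp_exchange)
  have g: "g (imp x y) = imp (g x) (g y)" "le x y \<Longrightarrow> le (g x) (g y)" "le x (g x)" "g (g x) = g x"
    for x y
    using Cons unfolding g_def[symmetric] closure_endomorphism_def monotone_def by auto
  show ?case
    unfolding eq closure_endomorphism_def monotone_def
  proof (intro conjI allI impI)
    fix x y
    show "imp p (g (imp x y)) = imp (imp p (g x)) (imp p (g y))"
      by (simp add: g(1) imp_imp[of p "g x"])
    show "le x y \<Longrightarrow> le (imp p (g x)) (imp p (g y))" by (intro imp_mono g(2))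
    show "le x (imp p (g x))" by (rule le_trans[OF g(3) le_imp])
    show "imp p (g (imp p (g x))) = imp p (g x)" by (simp add: comm g(4) imp_idem)
  qed
qed

lemma fg_closure_endomorphisms_comp:
  assumes "\<phi> \<in> fg_closure_endomorphisms le imp" "\<psi> \<in> fg_closure_endomorphisms le imp"
  shows "\<phi> \<circ> \<psi> \<in> fg_closure_endomorphisms le imp"
proof -
  obtain ps qs where "\<phi> = foldr (\<circ>) (map (principal_map imp) ps) id"
      "\<psi> = foldr (\<circ>) (map (principal_map imp) qs) id"
    using assms unfolding fg_closure_endomorphisms_def by auto
  moreover have "foldr (\<circ>) (map (principal_map imp) (ps @ qs)) id
      = foldr (\<circ>) (map (principal_map imp) ps) id \<circ> foldr (\<circ>) (map (principal_map imp) qs) id"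
    by (induction ps) (simp_all add: comp_assoc)
  ultimately have eq: "\<phi> \<circ> \<psi> = foldr (\<circ>) (map (principal_map imp) (ps @ qs)) id"
    by simp
  show ?thesis
    unfolding fg_closure_endomorphisms_def mem_Collect_eq
    using eq closure_endomorphism_composition[of "ps @ qs"] by metis
qed

lemma closure_endomorphism_comp_lub:
  assumes "closure_endomorphism le imp \<phi>" "closure_endomorphism le imp \<psi>"
      "closure_endomorphism le imp \<chi>"
  shows "(\<forall>x. le ((\<phi> \<circ> \<psi>) x) (\<chi> x)) \<longleftrightarrow> (\<forall>x. le (\<phi> x) (\<chi> x)) \<and> (\<forall>x. le (\<psi> x) (\<chi> x))"
proof (intro iffI conjI allI)
  fix x
  assume "\<forall>x. le ((\<phi> \<circ> \<psi>) x) (\<chi> x)"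
  then have *: "le (\<phi> (\<psi> x)) (\<chi> x)" by simp
  have "le x (\<psi> x)" "le (\<psi> x) (\<phi> (\<psi> x))"
    using assms by (auto simp: closure_endomorphism_def)
  moreover from this have "le (\<phi> x) (\<phi> (\<psi> x))"
    using assms(1) by (simp add: closure_endomorphism_def monotone_def)
  ultimately show "le (\<phi> x) (\<chi> x)" "le (\<psi> x) (\<chi> x)"
    using * by (blast intro: le_trans)+
next
  fix x
  assume "(\<forall>x. le (\<phi> x) (\<chi> x)) \<and> (\<forall>x. le (\<psi> x) (\<chi> x))"
  then have "le (\<phi> (\<psi> x)) (\<chi> (\<psi> x))" "le (\<psi> x) (\<chi> x)" by auto
  moreover from this(2) have "le (\<chi> (\<psi> x)) (\<chi> x)"
    using assms(3) unfolding closure_endomorphism_def monotone_def by metis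
  ultimately show "le ((\<phi> \<circ> \<psi>) x) (\<chi> x)" by (auto intro: le_trans)
qed

end

end

theory Submission
  imports Defs
begin

text \<open>Filters form an algebraic closure system: an arbitrary intersection of filters is a filter,
  and since modus ponens has only two premises, a set is a filter as soon as it contains the filter
  generated by each of its finite subsets. Two facts then give the theorem.

  The first is about Hilbert algebras (\<open>fg_closure_endomorphisms_iso_fg_filters\<close>). Modus ponens
  makes \<open>x\<close> a member of the filter generated by \<open>p\<^sub>1, \<dots>, p\<^sub>n\<close> exactly when
  \<open>p\<^sub>1 \<rightarrow> (\<dots> (p\<^sub>n \<rightarrow> x) \<dots>) = 1\<close>. So sending a closure endomorphism to its kernel
  \<open>{x. \<phi> x = 1}\<close> maps the adjoint semilattice onto the semilattice of finitely generated filters, and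
  it takes composition to the join of filters. It is injective because a finitely generated closure
  endomorphism is below every closure endomorphism whose kernel contains its generators.

  The second holds for any two algebraic closure systems (\<open>order_isomorphic_fg_closed_iff\<close>): they
  are isomorphic if and only if their finitely generated members are. The finitely generated
  members are exactly the compact ones, so an isomorphism of the whole systems restricts to them;
  and each closed set is the directed union of its finitely generated subsets, so an isomorphism
  between the finitely generated members extends along such unions.

  Passing between the algebraic and the order-theoretic notions of isomorphism is harmless, since
  meets and joins are determined by inclusion and inclusion is determined by joins.\<close>

section \<open>Order isomorphisms of set systems\<close>

definition order_iso :: "('a set \<Rightarrow> 'b set) \<Rightarrow> 'a set set \<Rightarrow> 'b set set \<Rightarrow> bool" where
  "order_iso f S T \<longleftrightarrow> bij_betw f S T \<and> (\<forall>X\<in>S. \<forall>Y\<in>S. f X \<subseteq> f Y \<longleftrightarrow> X \<subseteq> Y)"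

definition order_isomorphic :: "'a set set \<Rightarrow> 'b set set \<Rightarrow> bool" where
  "order_isomorphic S T \<longleftrightarrow> (\<exists>f. order_iso f S T)"

definition is_join_on :: "'a set set \<Rightarrow> ('a set \<Rightarrow> 'a set \<Rightarrow> 'a set) \<Rightarrow> bool" where
  "is_join_on S j \<longleftrightarrow>
     (\<forall>X\<in>S. \<forall>Y\<in>S. j X Y \<in> S \<and> (\<forall>Z\<in>S. j X Y \<subseteq> Z \<longleftrightarrow> X \<subseteq> Z \<and> Y \<subseteq> Z))"

lemma order_iso_inv:
  assumes "order_iso f S T"
  shows "order_iso (inv_into S f) T S"
proof -
  have bij: "bij_betw f S T" and le: "\<And>X Y. X \<in> S \<Longrightarrow> Y \<in> S \<Longrightarrow> f X \<subseteq> f Y \<longleftrightarrow> X \<subseteq> Y"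
    using assms by (auto simp: order_iso_def)
  have "inv_into S f X \<in> S" "f (inv_into S f X) = X" if "X \<in> T" for X
    using bij that bij_betw_inv_into_right[OF bij that] by (auto simp: bij_betw_def inv_into_into)
  then have "inv_into S f X \<subseteq> inv_into S f Y \<longleftrightarrow> X \<subseteq> Y" if "X \<in> T" "Y \<in> T" for X Y
    using le[of "inv_into S f X" "inv_into S f Y"] that by simp
  then show ?thesis
    using bij_betw_inv_into[OF bij] by (simp add: order_iso_def)
qed

lemma order_iso_mem: "order_iso f S T \<Longrightarrow> X \<in> S \<Longrightarrow> f X \<in> T"
  by (auto simp: order_iso_def bij_betw_def)

lemma order_iso_le: "order_iso f S T \<Longrightarrow> X \<in> S \<Longrightarrow> Y \<in> S \<Longrightarrow> f X \<subseteq> f Y \<longleftrightarrow> X \<subseteq> Y"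
  by (auto simp: order_iso_def)

lemma order_iso_inv_left: "order_iso f S T \<Longrightarrow> X \<in> S \<Longrightarrow> inv_into S f (f X) = X"
  by (auto simp: order_iso_def bij_betw_def)

lemma order_iso_inv_right: "order_iso f S T \<Longrightarrow> Y \<in> T \<Longrightarrow> f (inv_into S f Y) = Y"
  by (auto simp: order_iso_def bij_betw_inv_into_right)

lemma order_iso_of_inverse:
  assumes "\<And>X. X \<in> S \<Longrightarrow> f X \<in> T" and "\<And>Y. Y \<in> T \<Longrightarrow> g Y \<in> S"
    and "\<And>X. X \<in> S \<Longrightarrow> g (f X) = X" and "\<And>Y. Y \<in> T \<Longrightarrow> f (g Y) = Y"
    and "\<And>X X'. X \<subseteq> X' \<Longrightarrow> f X \<subseteq> f X'" and "\<And>Y Y'. Y \<subseteq> Y' \<Longrightarrow> g Y \<subseteq> g Y'"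
  shows "order_iso f S T"
  unfolding order_iso_def
proof (intro conjI ballI iffI)
  show "bij_betw f S T"
    using assms(1-4) by (intro bij_betw_byWitness[of S g f T]) auto
  show "X \<subseteq> Y" if "X \<in> S" "Y \<in> S" "f X \<subseteq> f Y" for X Y
    using assms(6)[OF that(3)] that assms(3) by simp
qed (rule assms(5))

lemma is_join_on_mem: "is_join_on S j \<Longrightarrow> X \<in> S \<Longrightarrow> Y \<in> S \<Longrightarrow> j X Y \<in> S"
  by (simp add: is_join_on_def)

lemma is_join_on_le:
  "is_join_on S j \<Longrightarrow> X \<in> S \<Longrightarrow> Y \<in> S \<Longrightarrow> Z \<in> S \<Longrightarrow> j X Y \<subseteq> Z \<longleftrightarrow> X \<subseteq> Z \<and> Y \<subseteq> Z"
  by (simp add: is_join_on_def)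

lemma is_join_on_upper:
  assumes "is_join_on S j" "X \<in> S" "Y \<in> S"
  shows "X \<subseteq> j X Y" "Y \<subseteq> j X Y"
  using is_join_on_le[OF assms is_join_on_mem[OF assms]] by simp_all

lemma subset_iff_join_eq:
  assumes "is_join_on S j" "X \<in> S" "Y \<in> S"
  shows "X \<subseteq> Y \<longleftrightarrow> j X Y = Y"
  using is_join_on_le[OF assms assms(3)] is_join_on_upper[OF assms] by auto

lemma join_preserving_iff_order_iso:
  assumes S: "is_join_on S j" and T: "is_join_on T k"
  shows "bij_betw f S T \<and> (\<forall>X\<in>S. \<forall>Y\<in>S. f (j X Y) = k (f X) (f Y)) \<longleftrightarrow> order_iso f S T"
proof
  assume f: "bij_betw f S T \<and> (\<forall>X\<in>S. \<forall>Y\<in>S. f (j X Y) = k (f X) (f Y))"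
  have "f X \<subseteq> f Y \<longleftrightarrow> X \<subseteq> Y" if XY: "X \<in> S" "Y \<in> S" for X Y
  proof -
    have fXY: "f X \<in> T" "f Y \<in> T" using f XY by (auto simp: bij_betw_def)
    have "f X \<subseteq> f Y \<longleftrightarrow> f (j X Y) = f Y"
      using subset_iff_join_eq[OF T fXY] f XY by simp
    also have "\<dots> \<longleftrightarrow> j X Y = Y"
      using inj_on_eq_iff[of f S "j X Y" Y] f XY is_join_on_mem[OF S XY]
      by (simp add: bij_betw_def)
    also have "\<dots> \<longleftrightarrow> X \<subseteq> Y"
      by (rule subset_iff_join_eq[OF S XY, symmetric])
    finally show ?thesis .
  qed
  then show "order_iso f S T" using f by (simp add: order_iso_def)
next
  assume f: "order_iso f S T"
  have "f (j X Y) = k (f X) (f Y)" if XY: "X \<in> S" "Y \<in> S" for X Y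
  proof
    have fXY: "f X \<in> T" "f Y \<in> T" using order_iso_mem[OF f] XY by auto
    have jS: "j X Y \<in> S" by (rule is_join_on_mem[OF S XY])
    have kT: "k (f X) (f Y) \<in> T" by (rule is_join_on_mem[OF T fXY])
    define Z where "Z = inv_into S f (k (f X) (f Y))"
    have Z: "Z \<in> S" "f Z = k (f X) (f Y)"
      unfolding Z_def
      using order_iso_inv_right[OF f kT] order_iso_mem[OF order_iso_inv[OF f] kT] by simp_all
    have "X \<subseteq> Z" "Y \<subseteq> Z"
      using is_join_on_upper[OF T fXY] order_iso_le[OF f _ Z(1)] XY Z(2) by simp_all
    then have "j X Y \<subseteq> Z" using is_join_on_le[OF S XY Z(1)] by simp
    then show "f (j X Y) \<subseteq> k (f X) (f Y)" using order_iso_le[OF f jS Z(1)] Z(2) by simp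
    show "k (f X) (f Y) \<subseteq> f (j X Y)"
      using is_join_on_upper[OF S XY] order_iso_le[OF f _ jS] XY
        is_join_on_le[OF T fXY order_iso_mem[OF f jS]] by simp
  qed
  then show "bij_betw f S T \<and> (\<forall>X\<in>S. \<forall>Y\<in>S. f (j X Y) = k (f X) (f Y))"
    using f by (simp add: order_iso_def)
qed

lemma isomorphic_semilattices_iff_order_isomorphic:
  assumes "is_join_on S j" "is_join_on T k"
  shows "isomorphic_semilattices S j T k \<longleftrightarrow> order_isomorphic S T"
  unfolding isomorphic_semilattices_def order_isomorphic_def
    join_preserving_iff_order_iso[OF assms] ..

lemma order_iso_Int:
  assumes f: "order_iso f S T" and X: "X \<in> S" and Y: "Y \<in> S"
    and S: "X \<inter> Y \<in> S" and T: "f X \<inter> f Y \<in> T"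
  shows "f (X \<inter> Y) = f X \<inter> f Y"
proof
  show "f (X \<inter> Y) \<subseteq> f X \<inter> f Y"
    using order_iso_le[OF f S X] order_iso_le[OF f S Y] by simp
  obtain Z where Z: "Z \<in> S" "f Z = f X \<inter> f Y"
    using order_iso_inv_right[OF f T] order_iso_mem[OF order_iso_inv[OF f] T] by blast
  then have "Z \<subseteq> X \<inter> Y"
    using order_iso_le[OF f Z(1) X] order_iso_le[OF f Z(1) Y] by simp
  then show "f X \<inter> f Y \<subseteq> f (X \<inter> Y)"
    using order_iso_le[OF f Z(1) S] Z(2) by simp
qed

lemma isomorphic_lattices_iff_order_isomorphic:
  assumes "is_join_on S j" "is_join_on T k"
    and "\<And>X Y. X \<in> S \<Longrightarrow> Y \<in> S \<Longrightarrow> X \<inter> Y \<in> S"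
    and "\<And>X Y. X \<in> T \<Longrightarrow> Y \<in> T \<Longrightarrow> X \<inter> Y \<in> T"
  shows "isomorphic_lattices S (\<inter>) j T (\<inter>) k \<longleftrightarrow> order_isomorphic S T"
proof -
  have "bij_betw f S T \<and>
      (\<forall>X\<in>S. \<forall>Y\<in>S. f (X \<inter> Y) = f X \<inter> f Y \<and> f (j X Y) = k (f X) (f Y)) \<longleftrightarrow>
      order_iso f S T" for f
  proof -
    have "f (X \<inter> Y) = f X \<inter> f Y" if f: "order_iso f S T" and XY: "X \<in> S" "Y \<in> S" for X Y
      using order_iso_Int[OF f XY] assms(3)[OF XY] assms(4) order_iso_mem[OF f] XY by simp
    then show ?thesis
      using join_preserving_iff_order_iso[OF assms(1,2), of f] by (simp add: ball_conj_distrib) blast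
  qed
  then show ?thesis by (simp add: isomorphic_lattices_def order_isomorphic_def)
qed

lemma isomorphic_semilattices_trans:
  assumes "isomorphic_semilattices S j T k" "isomorphic_semilattices T k U l"
  shows "isomorphic_semilattices S j U l"
proof -
  obtain f g where f: "bij_betw f S T" "\<forall>x\<in>S. \<forall>y\<in>S. f (j x y) = k (f x) (f y)"
    and g: "bij_betw g T U" "\<forall>x\<in>T. \<forall>y\<in>T. g (k x y) = l (g x) (g y)"
    using assms by (auto simp: isomorphic_semilattices_def)
  have "\<forall>x\<in>S. \<forall>y\<in>S. (g \<circ> f) (j x y) = l ((g \<circ> f) x) ((g \<circ> f) y)"
    using f g by (auto simp: bij_betw_def)
  then show ?thesis
    using bij_betw_trans[OF f(1) g(1)] unfolding isomorphic_semilattices_def by blast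
qed

lemma isomorphic_semilattices_sym:
  assumes "isomorphic_semilattices S j T k" and "\<And>x y. x \<in> S \<Longrightarrow> y \<in> S \<Longrightarrow> j x y \<in> S"
  shows "isomorphic_semilattices T k S j"
proof -
  obtain f where f: "bij_betw f S T" "\<forall>x\<in>S. \<forall>y\<in>S. f (j x y) = k (f x) (f y)"
    using assms by (auto simp: isomorphic_semilattices_def)
  have "inv_into S f (k x y) = j (inv_into S f x) (inv_into S f y)" if "x \<in> T" "y \<in> T" for x y
  proof -
    have "inv_into S f x \<in> S" "inv_into S f y \<in> S"
      using f(1) that by (auto simp: bij_betw_def inv_into_into)
    moreover from this have "f (j (inv_into S f x) (inv_into S f y)) = k x y"
      using f that by (simp add: bij_betw_inv_into_right)
    ultimately show ?thesis
      using f(1) assms(2) bij_betw_inv_into_left by metis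
  qed
  then show ?thesis
    using bij_betw_inv_into[OF f(1)] unfolding isomorphic_semilattices_def by blast
qed

section \<open>Algebraic closure systems\<close>

definition directed :: "'a set set \<Rightarrow> bool" where
  "directed D \<longleftrightarrow> D \<noteq> {} \<and> (\<forall>X\<in>D. \<forall>Y\<in>D. \<exists>Z\<in>D. X \<subseteq> Z \<and> Y \<subseteq> Z)"

lemma finite_subset_Union_directed:
  assumes "directed D" "finite P" "P \<subseteq> \<Union>D"
  shows "\<exists>X\<in>D. P \<subseteq> X"
  using assms(2,3)
proof (induction P)
  case empty
  then show ?case using assms(1) by (auto simp: directed_def)
next
  case (insert p P)
  then obtain X Y where "X \<in> D" "P \<subseteq> X" "Y \<in> D" "p \<in> Y" by auto
  moreover from this obtain Z where "Z \<in> D" "X \<subseteq> Z" "Y \<subseteq> Z"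
    using assms(1) unfolding directed_def by blast
  ultimately show ?case by blast
qed

locale algebraic_closure_system =
  fixes closed :: "'a set \<Rightarrow> bool"
  assumes closed_Inter: "\<And>\<X>. (\<And>X. X \<in> \<X> \<Longrightarrow> closed X) \<Longrightarrow> closed (\<Inter>\<X>)"
    and closed_if_finite_hulls:
      "\<And>X. (\<And>P. finite P \<Longrightarrow> P \<subseteq> X \<Longrightarrow> closed hull P \<subseteq> X) \<Longrightarrow> closed X"
begin

definition fg_closed :: "'a set set" where
  "fg_closed = {closed hull P |P. finite P}"

lemma closed_hull: "closed (closed hull X)"
  by (rule hull_in) (blast intro: closed_Inter)

lemma closed_fg: "X \<in> fg_closed \<Longrightarrow> closed X"
  by (auto simp: fg_closed_def closed_hull)

lemma closed_Union_directed:
  assumes "directed D" "\<And>X. X \<in> D \<Longrightarrow> closed X"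
  shows "closed (\<Union>D)"
proof (rule closed_if_finite_hulls)
  fix P assume "finite P" "P \<subseteq> \<Union>D"
  then obtain X where "X \<in> D" "P \<subseteq> X"
    using finite_subset_Union_directed[OF assms(1)] by blast
  then show "closed hull P \<subseteq> \<Union>D"
    using hull_minimal[of P X closed] assms(2) by blast
qed

text \<open>Finitely generated closed sets are compact: a directed union that contains such a set already
  has all its generators in one member.\<close>

lemma fg_closed_compact:
  assumes "directed D" "\<And>X. X \<in> D \<Longrightarrow> closed X" "Y \<in> fg_closed" "Y \<subseteq> \<Union>D"
  shows "\<exists>X\<in>D. Y \<subseteq> X"
proof -
  obtain P where P: "finite P" "Y = closed hull P" using assms(3) by (auto simp: fg_closed_def)
  then have "P \<subseteq> \<Union>D" using assms(4) hull_subset[of P closed] by blast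
  then obtain X where "X \<in> D" "P \<subseteq> X"
    using finite_subset_Union_directed[OF assms(1) P(1)] by blast
  then show ?thesis using hull_minimal[of P X closed] assms(2) P(2) by blast
qed

lemma fg_closed_join:
  assumes "X \<in> fg_closed" "Y \<in> fg_closed"
  shows "closed hull (X \<union> Y) \<in> fg_closed"
proof -
  obtain P Q where P: "finite P" "X = closed hull P" and Q: "finite Q" "Y = closed hull Q"
    using assms by (auto simp: fg_closed_def)
  have "closed hull (X \<union> Y) = closed hull (P \<union> Q)"
  proof
    show "closed hull (X \<union> Y) \<subseteq> closed hull (P \<union> Q)"
      unfolding P(2) Q(2) by (rule hull_minimal) (simp_all add: hull_mono closed_hull)
    show "closed hull (P \<union> Q) \<subseteq> closed hull (X \<union> Y)"
      unfolding P(2) Q(2) by (intro hull_mono Un_mono hull_subset)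
  qed
  then show ?thesis using P(1) Q(1) unfolding fg_closed_def by blast
qed

lemma is_join_on_closed: "is_join_on (Collect closed) (\<lambda>X Y. closed hull (X \<union> Y))"
  by (simp add: is_join_on_def closed_hull subset_hull)

lemma is_join_on_fg_closed: "is_join_on fg_closed (\<lambda>X Y. closed hull (X \<union> Y))"
  by (simp add: is_join_on_def fg_closed_join closed_fg subset_hull)

lemma directed_fg_subsets:
  assumes "closed X"
  shows "directed {Y \<in> fg_closed. Y \<subseteq> X}"
proof -
  have "closed hull {} \<in> {Y \<in> fg_closed. Y \<subseteq> X}"
    using hull_minimal[of "{}" X closed] assms by (auto simp: fg_closed_def)
  moreover have "\<exists>Z\<in>{Y \<in> fg_closed. Y \<subseteq> X}. Y \<subseteq> Z \<and> Y' \<subseteq> Z"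
    if "Y \<in> {Y \<in> fg_closed. Y \<subseteq> X}" "Y' \<in> {Y \<in> fg_closed. Y \<subseteq> X}" for Y Y'
  proof (rule bexI[of _ "closed hull (Y \<union> Y')"])
    show "Y \<subseteq> closed hull (Y \<union> Y') \<and> Y' \<subseteq> closed hull (Y \<union> Y')"
      using hull_subset[of "Y \<union> Y'" closed] by blast
    show "closed hull (Y \<union> Y') \<in> {Y \<in> fg_closed. Y \<subseteq> X}"
      using that assms by (simp add: fg_closed_join subset_hull)
  qed
  ultimately show ?thesis unfolding directed_def by blast
qed

lemma Union_fg_subsets:
  assumes "closed X"
  shows "\<Union>{Y \<in> fg_closed. Y \<subseteq> X} = X"
proof (intro equalityI subsetI)
  fix x assume "x \<in> X"
  then have "closed hull {x} \<in> {Y \<in> fg_closed. Y \<subseteq> X}"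
    using hull_minimal[of "{x}" X closed] assms by (auto simp: fg_closed_def)
  then show "x \<in> \<Union>{Y \<in> fg_closed. Y \<subseteq> X}"
    using hull_subset[of "{x}" closed] by blast
qed auto

end

lemma directed_order_iso_image:
  assumes "order_iso f S T" "D \<subseteq> S" "directed D"
  shows "directed (f ` D)"
  unfolding directed_def
proof (intro conjI ballI)
  show "f ` D \<noteq> {}" using assms(3) by (simp add: directed_def)
  fix X Y assume "X \<in> f ` D" "Y \<in> f ` D"
  then obtain X' Y' where XY: "X' \<in> D" "Y' \<in> D" "X = f X'" "Y = f Y'" by blast
  then obtain Z where "Z \<in> D" "X' \<subseteq> Z" "Y' \<subseteq> Z" using assms(3) unfolding directed_def by blast
  then have "f Z \<in> f ` D" "X \<subseteq> f Z" "Y \<subseteq> f Z"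
    using XY order_iso_le[OF assms(1), of X' Z] order_iso_le[OF assms(1), of Y' Z] assms(2)
    by blast+
  then show "\<exists>Z\<in>f ` D. X \<subseteq> Z \<and> Y \<subseteq> Z" by blast
qed

text \<open>Compactness is an order-theoretic property. The image of a finitely generated set \<open>X\<close> is the
  directed union of its finitely generated subsets; pulled back, these form a directed family with
  union \<open>X\<close>, so one member of it is \<open>X\<close> itself.\<close>

lemma order_iso_maps_fg_closed:
  assumes "algebraic_closure_system S" "algebraic_closure_system T"
    and f: "order_iso f (Collect S) (Collect T)"
    and X: "X \<in> algebraic_closure_system.fg_closed S"
  shows "f X \<in> algebraic_closure_system.fg_closed T"
proof -
  interpret S: algebraic_closure_system S by fact
  interpret T: algebraic_closure_system T by fact
  define g where "g = inv_into (Collect S) f"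
  have g: "order_iso g (Collect T) (Collect S)" unfolding g_def by (rule order_iso_inv[OF f])
  have SX: "X \<in> Collect S" using X S.closed_fg by simp
  then have TfX: "T (f X)" using order_iso_mem[OF f] by blast
  have gfX: "g (f X) = X" unfolding g_def by (rule order_iso_inv_left[OF f SX])
  define D where "D = {Y \<in> T.fg_closed. Y \<subseteq> f X}"
  have D: "directed D" "\<Union>D = f X" "D \<subseteq> Collect T"
    unfolding D_def using T.directed_fg_subsets T.Union_fg_subsets TfX T.closed_fg by auto
  have dir: "directed (g ` D)" by (rule directed_order_iso_image[OF g D(3,1)])
  have cl: "S Y" if "Y \<in> g ` D" for Y using that order_iso_mem[OF g] D(3) by auto
  let ?U = "\<Union>(g ` D)"
  have U: "?U \<in> Collect S" using S.closed_Union_directed[OF dir cl] by simp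
  have "Y \<subseteq> f ?U" if "Y \<in> D" for Y
  proof -
    have Y: "Y \<in> Collect T" using that D(3) by blast
    then have "f (g Y) = Y" unfolding g_def by (rule order_iso_inv_right[OF f])
    moreover have "g Y \<subseteq> ?U" using that by blast
    ultimately show ?thesis using order_iso_le[OF f order_iso_mem[OF g Y] U] by simp
  qed
  then have "f X \<subseteq> f ?U" using D(2) by blast
  then have "X \<subseteq> ?U" using order_iso_le[OF f SX U] by simp
  then obtain Y where Y: "Y \<in> D" "X \<subseteq> g Y"
    using S.fg_closed_compact[OF dir cl X] by blast
  then have "f X \<subseteq> Y" using order_iso_le[OF g, of "f X" Y] gfX D(3) TfX by auto
  then have "f X = Y" using Y(1) D(2) by blast
  then show ?thesis using Y(1) by (simp add: D_def)
qed

definition extend_by_unions :: "'a set set \<Rightarrow> ('a set \<Rightarrow> 'b set) \<Rightarrow> 'a set \<Rightarrow> 'b set" where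
  "extend_by_unions F f X = \<Union>(f ` {Y \<in> F. Y \<subseteq> X})"

lemma extend_by_unions_mono: "X \<subseteq> X' \<Longrightarrow> extend_by_unions F f X \<subseteq> extend_by_unions F f X'"
  by (auto simp: extend_by_unions_def)

context
  fixes S :: "'a set \<Rightarrow> bool" and T :: "'b set \<Rightarrow> bool" and f :: "'a set \<Rightarrow> 'b set"
  assumes S: "algebraic_closure_system S" and T: "algebraic_closure_system T"
    and f: "order_iso f (algebraic_closure_system.fg_closed S)
              (algebraic_closure_system.fg_closed T)"
begin

interpretation S: algebraic_closure_system S by (rule S)
interpretation T: algebraic_closure_system T by (rule T)

lemma directed_image_fg_subsets: "S X \<Longrightarrow> directed (f ` {Y \<in> S.fg_closed. Y \<subseteq> X})"
  by (rule directed_order_iso_image[OF f]) (auto simp: S.directed_fg_subsets)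

lemma closed_image_fg_subsets: "Y \<in> f ` {Y \<in> S.fg_closed. Y \<subseteq> X} \<Longrightarrow> T Y"
  using order_iso_mem[OF f] T.closed_fg by auto

lemma closed_extend_by_unions: "S X \<Longrightarrow> T (extend_by_unions S.fg_closed f X)"
  unfolding extend_by_unions_def
  by (rule T.closed_Union_directed[OF directed_image_fg_subsets closed_image_fg_subsets])

text \<open>By compactness, a finitely generated set below the extended image of \<open>X\<close> lies below the image
  of a single finitely generated subset of \<open>X\<close>, so going back does not leave \<open>X\<close>.\<close>

lemma extend_by_unions_inverse:
  assumes X: "S X"
  shows "extend_by_unions T.fg_closed (inv_into S.fg_closed f)
           (extend_by_unions S.fg_closed f X) = X"
proof (intro equalityI subsetI)
  let ?g = "inv_into S.fg_closed f" and ?Y = "extend_by_unions S.fg_closed f X"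
  have g: "order_iso ?g T.fg_closed S.fg_closed" by (rule order_iso_inv[OF f])
  fix x
  assume "x \<in> extend_by_unions T.fg_closed ?g ?Y"
  then obtain Y where Y: "Y \<in> T.fg_closed" "Y \<subseteq> ?Y" "x \<in> ?g Y"
    by (auto simp: extend_by_unions_def)
  have "\<exists>Z'\<in>f ` {Z \<in> S.fg_closed. Z \<subseteq> X}. Y \<subseteq> Z'"
    by (rule T.fg_closed_compact[OF directed_image_fg_subsets[OF X] closed_image_fg_subsets Y(1)])
      (use Y(2) in \<open>simp_all add: extend_by_unions_def\<close>)
  then obtain Z where Z: "Z \<in> S.fg_closed" "Z \<subseteq> X" "Y \<subseteq> f Z"
    by blast
  then have "?g Y \<subseteq> ?g (f Z)" using order_iso_le[OF g Y(1) order_iso_mem[OF f]] by blast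
  then show "x \<in> X" using Y(3) Z order_iso_inv_left[OF f Z(1)] by auto
next
  let ?g = "inv_into S.fg_closed f" and ?Y = "extend_by_unions S.fg_closed f X"
  fix x assume "x \<in> X"
  then obtain Z where Z: "Z \<in> S.fg_closed" "Z \<subseteq> X" "x \<in> Z"
    using S.Union_fg_subsets[OF X] by blast
  then have "f Z \<in> T.fg_closed" "f Z \<subseteq> ?Y" "x \<in> ?g (f Z)"
    using order_iso_mem[OF f] order_iso_inv_left[OF f] by (auto simp: extend_by_unions_def)
  then show "x \<in> extend_by_unions T.fg_closed ?g ?Y"
    unfolding extend_by_unions_def[of T.fg_closed] by blast
qed

end

theorem order_isomorphic_fg_closed_iff:
  assumes S: "algebraic_closure_system S" and T: "algebraic_closure_system T"
  shows "order_isomorphic (algebraic_closure_system.fg_closed S)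
           (algebraic_closure_system.fg_closed T) \<longleftrightarrow>
         order_isomorphic (Collect S) (Collect T)"
proof
  interpret S: algebraic_closure_system S by fact
  interpret T: algebraic_closure_system T by fact
  assume "order_isomorphic S.fg_closed T.fg_closed"
  then obtain f where f: "order_iso f S.fg_closed T.fg_closed"
    by (auto simp: order_isomorphic_def)
  define g where "g = inv_into S.fg_closed f"
  have g: "order_iso g T.fg_closed S.fg_closed" unfolding g_def by (rule order_iso_inv[OF f])
  \<comment> \<open>Both composites of the two extensions are identities by the same lemma, because \<open>f\<close> agrees
    with the inverse of \<open>g\<close> on the finitely generated sets.\<close>
  have "inv_into T.fg_closed g X = f X" if "X \<in> S.fg_closed" for X
    using order_iso_inv_left[OF g order_iso_mem[OF f that]] order_iso_inv_left[OF f that]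
    by (simp add: g_def)
  then have f_eq: "extend_by_unions S.fg_closed (inv_into T.fg_closed g) X =
      extend_by_unions S.fg_closed f X" for X
    by (auto simp: extend_by_unions_def)
  have "order_iso (extend_by_unions S.fg_closed f) (Collect S) (Collect T)"
  proof (rule order_iso_of_inverse[where g = "extend_by_unions T.fg_closed g"])
    show "extend_by_unions S.fg_closed f X \<in> Collect T" if "X \<in> Collect S" for X
      using closed_extend_by_unions[OF S T f] that by simp
    show "extend_by_unions T.fg_closed g Y \<in> Collect S" if "Y \<in> Collect T" for Y
      using closed_extend_by_unions[OF T S g] that by simp
    show "extend_by_unions T.fg_closed g (extend_by_unions S.fg_closed f X) = X"
      if "X \<in> Collect S" for X
      using extend_by_unions_inverse[OF S T f] that by (simp add: g_def)
    show "extend_by_unions S.fg_closed f (extend_by_unions T.fg_closed g Y) = Y"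
      if "Y \<in> Collect T" for Y
      using extend_by_unions_inverse[OF T S g] that by (simp add: f_eq)
  qed (simp_all add: extend_by_unions_mono)
  then show "order_isomorphic (Collect S) (Collect T)" by (auto simp: order_isomorphic_def)
next
  interpret S: algebraic_closure_system S by fact
  interpret T: algebraic_closure_system T by fact
  assume "order_isomorphic (Collect S) (Collect T)"
  then obtain f where f: "order_iso f (Collect S) (Collect T)"
    by (auto simp: order_isomorphic_def)
  have "f ` S.fg_closed = T.fg_closed"
  proof (intro equalityI subsetI)
    show "Y \<in> T.fg_closed" if "Y \<in> f ` S.fg_closed" for Y
      using order_iso_maps_fg_closed[OF S T f] that by blast
    show "Y \<in> f ` S.fg_closed" if "Y \<in> T.fg_closed" for Y
      using order_iso_maps_fg_closed[OF T S order_iso_inv[OF f] that]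
        order_iso_inv_right[OF f] T.closed_fg[OF that] by (metis image_eqI mem_Collect_eq)
  qed
  moreover have "S.fg_closed \<subseteq> Collect S" using S.closed_fg by blast
  ultimately have "order_iso f S.fg_closed T.fg_closed"
    using f inj_on_subset[of f "Collect S" S.fg_closed]
    by (simp add: order_iso_def bij_betw_def S.closed_fg)
  then show "order_isomorphic S.fg_closed T.fg_closed" by (auto simp: order_isomorphic_def)
qed

section \<open>Finitely generated closure endomorphisms and filters\<close>

lemma algebraic_closure_system_hilbert_filter:
  "algebraic_closure_system (hilbert_filter imp one)"
proof
  show "hilbert_filter imp one (\<Inter>\<X>)" if "\<And>X. X \<in> \<X> \<Longrightarrow> hilbert_filter imp one X" for \<X>
    using that unfolding hilbert_filter_def by blast
  have in_hull: "z \<in> hilbert_filter imp one hull P"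
    if "\<And>J. hilbert_filter imp one J \<Longrightarrow> P \<subseteq> J \<Longrightarrow> z \<in> J" for z P
    using that by (auto simp: hull_def)
  fix X
  assume fin: "\<And>P. finite P \<Longrightarrow> P \<subseteq> X \<Longrightarrow> hilbert_filter imp one hull P \<subseteq> X"
  show "hilbert_filter imp one X"
    unfolding hilbert_filter_def
  proof (intro conjI allI impI)
    show "one \<in> X"
      using fin[of "{}"] in_hull[of "{}" one] by (auto simp: hilbert_filter_def)
    show "y \<in> X" if "x \<in> X" "imp x y \<in> X" for x y
      using fin[of "{x, imp x y}"] in_hull[of "{x, imp x y}" y] that
      by (auto simp: hilbert_filter_def)
  qed
qed

abbreviation fg_filters :: "('a \<Rightarrow> 'a \<Rightarrow> 'a) \<Rightarrow> 'a \<Rightarrow> 'a set set" where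
  "fg_filters imp one \<equiv> algebraic_closure_system.fg_closed (hilbert_filter imp one)"

lemma fg_filters_eq: "fg_filters imp one = {hilbert_filter imp one hull P |P. finite P}"
  by (rule algebraic_closure_system.fg_closed_def[OF algebraic_closure_system_hilbert_filter])

lemma filter_join_eq: "filter_join imp one = (\<lambda>X Y. hilbert_filter imp one hull (X \<union> Y))"
  by (simp add: filter_join_def fun_eq_iff)

context hilbert_algebra
begin

definition principal_composition :: "'a list \<Rightarrow> 'a \<Rightarrow> 'a" where
  "principal_composition ps = foldr (\<circ>) (map (principal_map imp) ps) id"

lemma principal_composition_simps [simp]:
  "principal_composition [] x = x"
  "principal_composition (p # ps) x = imp p (principal_composition ps x)"
  by (simp_all add: principal_composition_def principal_map_def)

lemma closure_endomorphism_principal_composition: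
  "closure_endomorphism le imp (principal_composition ps)"
  unfolding principal_composition_def by (rule closure_endomorphism_composition)

definition endo_kernel :: "('a \<Rightarrow> 'a) \<Rightarrow> 'a set" where
  "endo_kernel \<phi> = {x. \<phi> x = one}"

lemma imp_one: "imp x one = one"
  by (simp add: imp_eq_one_iff le_one)

lemma fg_closure_endomorphisms_eq: "fg_closure_endomorphisms le imp = range principal_composition"
  using closure_endomorphism_composition
  by (auto simp: fg_closure_endomorphisms_def principal_composition_def)

lemma principal_composition_append:
  "principal_composition (ps @ qs) = principal_composition ps \<circ> principal_composition qs"
  by (rule ext, induction ps) simp_all

lemma closure_endomorphism_one:
  assumes "closure_endomorphism le imp \<phi>"
  shows "\<phi> one = one"
  using assms le_antisym[OF le_one] by (auto simp: closure_endomorphism_def)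

lemma hilbert_filter_endo_kernel:
  assumes "closure_endomorphism le imp \<phi>"
  shows "hilbert_filter imp one (endo_kernel \<phi>)"
proof -
  have "\<phi> (imp x y) = imp (\<phi> x) (\<phi> y)" for x y
    using assms by (simp add: closure_endomorphism_def)
  then show ?thesis
    using closure_endomorphism_one[OF assms]
    by (simp add: hilbert_filter_def endo_kernel_def one_imp)
qed

text \<open>A set closed under modus ponens that contains all \<open>p \<in> set ps\<close> may strip the premises off
  \<open>p\<^sub>1 \<rightarrow> (\<dots> (p\<^sub>n \<rightarrow> x) \<dots>)\<close> one at a time.\<close>

lemma filter_mem_if_principal_composition_mem:
  assumes "hilbert_filter imp one J" "set ps \<subseteq> J" "principal_composition ps x \<in> J"
  shows "x \<in> J"
  using assms(2,3)
proof (induction ps)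
  case (Cons p ps)
  then have "p \<in> J" "imp p (principal_composition ps x) \<in> J" by simp_all
  then have "principal_composition ps x \<in> J"
    using assms(1) unfolding hilbert_filter_def by blast
  with Cons show ?case by simp
qed simp

lemma principal_composition_generator: "p \<in> set ps \<Longrightarrow> principal_composition ps p = one"
proof (induction ps)
  case (Cons q ps)
  show ?case
  proof (cases "p \<in> set ps")
    case True
    then show ?thesis using Cons.IH by (simp add: imp_one)
  next
    case False
    moreover have "le p (principal_composition ps p)"
      using closure_endomorphism_principal_composition[of ps] by (simp add: closure_endomorphism_def)
    ultimately show ?thesis using Cons.prems by (simp add: imp_eq_one_iff)
  qed
qed simp

lemma endo_kernel_principal_composition:
  "endo_kernel (principal_composition ps) = hilbert_filter imp one hull set ps"
proof
  show "hilbert_filter imp one hull set ps \<subseteq> endo_kernel (principal_composition ps)"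
  proof (rule hull_minimal)
    show "hilbert_filter imp one (endo_kernel (principal_composition ps))"
      by (rule hilbert_filter_endo_kernel[OF closure_endomorphism_principal_composition])
  qed (auto simp: endo_kernel_def principal_composition_generator)
  show "endo_kernel (principal_composition ps) \<subseteq> hilbert_filter imp one hull set ps"
  proof
    fix x assume x: "x \<in> endo_kernel (principal_composition ps)"
    have F: "hilbert_filter imp one (hilbert_filter imp one hull set ps)"
      by (rule algebraic_closure_system.closed_hull[OF algebraic_closure_system_hilbert_filter])
    then have "principal_composition ps x \<in> hilbert_filter imp one hull set ps"
      using x by (simp add: endo_kernel_def hilbert_filter_def)
    with F show "x \<in> hilbert_filter imp one hull set ps"
      by (rule filter_mem_if_principal_composition_mem[OF _ hull_subset])
  qed
qed

text \<open>If \<open>\<psi>\<close> sends every generator \<open>p\<close> to \<open>1\<close>, then applying the endomorphism \<open>\<psi>\<close> to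
  \<open>p\<^sub>1 \<rightarrow> (\<dots> (p\<^sub>n \<rightarrow> x) \<dots>)\<close> erases all the premises and gives \<open>\<psi> x\<close>; and \<open>\<psi>\<close> is extensive.\<close>

lemma principal_composition_le:
  assumes "closure_endomorphism le imp \<psi>" "set ps \<subseteq> endo_kernel \<psi>"
  shows "le (principal_composition ps x) (\<psi> x)"
proof -
  have "\<psi> (principal_composition ps x) = \<psi> x"
    using assms(2)
    by (induction ps) (use assms(1) in
      \<open>simp_all add: endo_kernel_def closure_endomorphism_def one_imp\<close>)
  moreover have "le (principal_composition ps x) (\<psi> (principal_composition ps x))"
    using assms(1) by (simp add: closure_endomorphism_def)
  ultimately show ?thesis by simp
qed

lemma inj_on_endo_kernel: "inj_on endo_kernel (fg_closure_endomorphisms le imp)"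
proof -
  have le: "le (principal_composition ps x) (principal_composition qs x)"
    if "endo_kernel (principal_composition ps) = endo_kernel (principal_composition qs)" for ps qs x
    by (rule principal_composition_le[OF closure_endomorphism_principal_composition])
      (use that endo_kernel_principal_composition hull_subset in metis)
  show ?thesis
    unfolding fg_closure_endomorphisms_eq
    by (auto intro!: inj_onI ext le_antisym le)
qed

theorem fg_closure_endomorphisms_iso_fg_filters:
  "isomorphic_semilattices (fg_closure_endomorphisms le imp) (\<circ>)
     (fg_filters imp one) (filter_join imp one)"
  unfolding isomorphic_semilattices_def
proof (intro exI[of _ endo_kernel] conjI ballI)
  have "endo_kernel ` fg_closure_endomorphisms le imp = fg_filters imp one"
    unfolding fg_closure_endomorphisms_eq fg_filters_eq image_image
      endo_kernel_principal_composition
    by (auto dest: finite_list)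
  then show "bij_betw endo_kernel (fg_closure_endomorphisms le imp) (fg_filters imp one)"
    using inj_on_endo_kernel by (simp add: bij_betw_def)
  fix \<phi> \<psi>
  assume "\<phi> \<in> fg_closure_endomorphisms le imp" "\<psi> \<in> fg_closure_endomorphisms le imp"
  then obtain ps qs where eq: "\<phi> = principal_composition ps" "\<psi> = principal_composition qs"
    by (auto simp: fg_closure_endomorphisms_eq)
  have "endo_kernel (\<phi> \<circ> \<psi>) = hilbert_filter imp one hull (set ps \<union> set qs)"
    unfolding eq principal_composition_append[symmetric] endo_kernel_principal_composition by simp
  also have "\<dots> = filter_join imp one (endo_kernel \<phi>) (endo_kernel \<psi>)"
  proof (rule antisym)
    show "hilbert_filter imp one hull (set ps \<union> set qs)
        \<subseteq> filter_join imp one (endo_kernel \<phi>) (endo_kernel \<psi>)"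
      unfolding eq filter_join_def endo_kernel_principal_composition
      by (intro hull_mono Un_mono hull_subset)
    show "filter_join imp one (endo_kernel \<phi>) (endo_kernel \<psi>)
        \<subseteq> hilbert_filter imp one hull (set ps \<union> set qs)"
      unfolding eq endo_kernel_principal_composition
      using algebraic_closure_system.closed_hull[OF algebraic_closure_system_hilbert_filter]
      by (subst filter_join_lub(2)) (auto intro: hull_mono[THEN subsetD, rotated])
  qed
  finally show "endo_kernel (\<phi> \<circ> \<psi>) = filter_join imp one (endo_kernel \<phi>) (endo_kernel \<psi>)" .
qed

end

theorem theorem5p4:
  fixes le\<^sub>A :: "'a \<Rightarrow> 'a \<Rightarrow> bool" and imp\<^sub>A :: "'a \<Rightarrow> 'a \<Rightarrow> 'a" and one\<^sub>A :: 'a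
    and le\<^sub>B :: "'b \<Rightarrow> 'b \<Rightarrow> bool" and imp\<^sub>B :: "'b \<Rightarrow> 'b \<Rightarrow> 'b" and one\<^sub>B :: 'b
  assumes "hilbert_algebra le\<^sub>A imp\<^sub>A one\<^sub>A"
    and "hilbert_algebra le\<^sub>B imp\<^sub>B one\<^sub>B"
  shows "isomorphic_semilattices
           (fg_closure_endomorphisms le\<^sub>A imp\<^sub>A) (\<circ>)
           (fg_closure_endomorphisms le\<^sub>B imp\<^sub>B) (\<circ>) \<longleftrightarrow>
         isomorphic_lattices
           {J. hilbert_filter imp\<^sub>A one\<^sub>A J} (\<inter>) (filter_join imp\<^sub>A one\<^sub>A)
           {J. hilbert_filter imp\<^sub>B one\<^sub>B J} (\<inter>) (filter_join imp\<^sub>B one\<^sub>B)"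
proof -
  interpret A: hilbert_algebra le\<^sub>A imp\<^sub>A one\<^sub>A by fact
  interpret B: hilbert_algebra le\<^sub>B imp\<^sub>B one\<^sub>B by fact
  note acs = algebraic_closure_system_hilbert_filter
  note fg_join = algebraic_closure_system.is_join_on_fg_closed[OF acs, folded filter_join_eq]
  note join = algebraic_closure_system.is_join_on_closed[OF acs, folded filter_join_eq]
  note isoA = A.fg_closure_endomorphisms_iso_fg_filters
  note isoB = B.fg_closure_endomorphisms_iso_fg_filters
  note isoA' = isomorphic_semilattices_sym[OF isoA A.fg_closure_endomorphisms_comp]
  note isoB' = isomorphic_semilattices_sym[OF isoB B.fg_closure_endomorphisms_comp]
  have "isomorphic_semilattices (fg_closure_endomorphisms le\<^sub>A imp\<^sub>A) (\<circ>)
      (fg_closure_endomorphisms le\<^sub>B imp\<^sub>B) (\<circ>) \<longleftrightarrow>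
    isomorphic_semilattices (fg_filters imp\<^sub>A one\<^sub>A) (filter_join imp\<^sub>A one\<^sub>A)
      (fg_filters imp\<^sub>B one\<^sub>B) (filter_join imp\<^sub>B one\<^sub>B)"
    using isomorphic_semilattices_trans[OF isoA' isomorphic_semilattices_trans[OF _ isoB]]
      isomorphic_semilattices_trans[OF isoA isomorphic_semilattices_trans[OF _ isoB']]
    by blast
  also have "\<dots> \<longleftrightarrow> order_isomorphic (fg_filters imp\<^sub>A one\<^sub>A) (fg_filters imp\<^sub>B one\<^sub>B)"
    by (rule isomorphic_semilattices_iff_order_isomorphic[OF fg_join fg_join])
  also have "\<dots> \<longleftrightarrow>
      order_isomorphic {J. hilbert_filter imp\<^sub>A one\<^sub>A J} {J. hilbert_filter imp\<^sub>B one\<^sub>B J}"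
    by (rule order_isomorphic_fg_closed_iff[OF acs acs])
  also have "\<dots> \<longleftrightarrow> isomorphic_lattices
      {J. hilbert_filter imp\<^sub>A one\<^sub>A J} (\<inter>) (filter_join imp\<^sub>A one\<^sub>A)
      {J. hilbert_filter imp\<^sub>B one\<^sub>B J} (\<inter>) (filter_join imp\<^sub>B one\<^sub>B)"
    by (rule isomorphic_lattices_iff_order_isomorphic[OF join join, symmetric])
      (simp_all add: filter_meet)
  finally show ?thesis .
qed

end
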